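(* Suppose that $\kappa$ is an infinite cardinal. Then the colouring $\Delta_\kappa:[2^\kappa]^2\to\kappa$ is a maximal triangle-free colouring into $\kappa$.
   Context: $2^\kappa$ denotes the set of all functions from $\kappa$ to $2=\{0,1\}$, and $[X]^2$ is the set of two-element subsets of $X$. $\Delta_\kappa:[2^\kappa]^2\to\kappa$ is defined by $\Delta_\kappa(\{x,y\})=\min\{i<\kappa: x(i)\neq y(i)\}$. For a colouring $c$ of $[X]^2$, a monochromatic triangle is a three-element set $T\subseteq X$ such that $c\restriction[T]^2$ is constant. A colouring $c:[X]^2\to\kappa$ is a maximal triangle-free colouring into $\kappa$ if (1) $c$ has no monochromatic triangles; and (2) for any proper superset $Y\supsetneq X$ and any extension of $c$ to $c':[Y]^2\to\kappa$, $c'$ has a monochromatic triangle. *)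

theory Defs
  imports Main "HOL-Library.FuncSet" "HOL-Library.Ramsey"
begin

text \<open>
  A cardinal \<open>\<kappa>\<close> is given by a cardinal order \<open>r\<close> in the sense of the HOL cardinals library: a
  well-order relation of minimal order type among those on its field. The field of \<open>r\<close> plays the
  role of the set of ordinals below \<open>\<kappa>\<close>. The set \<open>[X]\<^bsup>2\<^esup>\<close> is \<^const>\<open>nsets\<close>.
\<close>

definition two_pow :: "'k rel \<Rightarrow> ('k \<Rightarrow> nat) set" where
  "two_pow r = Field r \<rightarrow>\<^sub>E {0, 1}"

text \<open>
  The function \<open>\<Delta>\<close> takes a two-element set \<open>{x, y}\<close> as its argument; the set being minimised over
  is then \<open>{i \<in> Field r. x i \<noteq> y i}\<close>, see the lemma below.
\<close>

definition Delta :: "'k rel \<Rightarrow> ('k \<Rightarrow> nat) set \<Rightarrow> 'k" where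
  "Delta r e = wo_rel.minim r {i \<in> Field r. \<exists>x\<in>e. \<exists>y\<in>e. x i \<noteq> y i}"

lemma Delta_pair: "Delta r {x, y} = wo_rel.minim r {i \<in> Field r. x i \<noteq> y i}"
proof -
  have "{i \<in> Field r. \<exists>u\<in>{x, y}. \<exists>v\<in>{x, y}. u i \<noteq> v i} = {i \<in> Field r. x i \<noteq> y i}"
    by auto
  then show ?thesis by (simp add: Delta_def)
qed

definition monochromatic_triangle :: "'a set \<Rightarrow> ('a set \<Rightarrow> 'k) \<Rightarrow> 'a set \<Rightarrow> bool" where
  "monochromatic_triangle X c T \<longleftrightarrow> T \<in> [X]\<^bsup>3\<^esup> \<and> (\<exists>k. \<forall>e\<in>[T]\<^bsup>2\<^esup>. c e = k)"

text \<open>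
  If \<open>X\<close> exhausts its type, it has no proper supersets within that type. Supersets of \<open>X\<close> are
  therefore taken in the type \<open>'a + 'b\<close>, into which \<open>X\<close> is embedded by \<^const>\<open>Inl\<close>; the
  points of a superset outside \<open>X\<close> may thus come from an arbitrary type \<open>'b\<close>. As a definition cannot
  quantify over types, \<open>'b\<close> is a parameter, to be left as a type variable in theorems.
\<close>

definition maximal_triangle_free_colouring ::
    "'b itself \<Rightarrow> 'k set \<Rightarrow> 'a set \<Rightarrow> ('a set \<Rightarrow> 'k) \<Rightarrow> bool" where
  "maximal_triangle_free_colouring (_ :: 'b itself) K X c \<longleftrightarrow>
     c \<in> [X]\<^bsup>2\<^esup> \<rightarrow> K \<and>
     (\<nexists>T. monochromatic_triangle X c T) \<and>
     (\<forall>(Y :: ('a + 'b) set) c'.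
        Inl ` X \<subset> Y \<longrightarrow>
        c' \<in> [Y]\<^bsup>2\<^esup> \<rightarrow> K \<longrightarrow>
        (\<forall>e\<in>[X]\<^bsup>2\<^esup>. c' (Inl ` e) = c e) \<longrightarrow>
        (\<exists>T. monochromatic_triangle Y c' T))"

end

theory Submission imports Defs begin

text \<open>
  Three functions with the same pairwise first difference \<open>i\<close> would take three distinct values at
  \<open>i\<close>. For maximality, a new point \<open>z\<close> induces the colouring \<open>f x = c' {z, x}\<close> of \<open>2\<^sup>\<kappa>\<close>. Diagonalise
  against \<open>f\<close>: recursively choose \<open>x i\<close> to be \<open>0\<close> exactly if some \<open>y\<close> of colour \<open>i\<close> extends
  \<open>x \<restriction> i\<close> with \<open>y i = 1\<close>. At \<open>i = f x\<close> the value \<open>x i = 1\<close> is impossible, as \<open>x\<close> itself would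
  be such a \<open>y\<close>; so there is such a \<open>y\<close>, and \<open>z, x, y\<close> is monochromatic.
\<close>

text \<open>The two-element subsets of a triple are its three pairs, so being constant on them comes
  down to two equations, both measured against the pair \<open>{x, z}\<close>.\<close>

lemma monochromatic_triangle_iff:
  "monochromatic_triangle X c T \<longleftrightarrow>
    (\<exists>x y z. T = {x, y, z} \<and> {x, y, z} \<subseteq> X \<and> x \<noteq> y \<and> x \<noteq> z \<and> y \<noteq> z \<and>
       c {x, y} = c {x, z} \<and> c {y, z} = c {x, z})"
  (is "?L \<longleftrightarrow> ?R")
proof
  assume ?L
  then obtain k where T: "T \<in> [X]\<^bsup>3\<^esup>" and k: "\<And>e. e \<in> [T]\<^bsup>2\<^esup> \<Longrightarrow> c e = k"
    unfolding monochromatic_triangle_def by blast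
  from T obtain x y z where xyz: "T = {x, y, z}" "x \<noteq> y" "x \<noteq> z" "y \<noteq> z" "T \<subseteq> X"
    by (auto simp: nsets_def card_3_iff)
  then have "{x, y} \<in> [T]\<^bsup>2\<^esup>" "{x, z} \<in> [T]\<^bsup>2\<^esup>" "{y, z} \<in> [T]\<^bsup>2\<^esup>"
    by (auto simp: nsets_def)
  with k xyz show ?R by metis
next
  assume ?R
  then obtain x y z where xyz: "T = {x, y, z}" "{x, y, z} \<subseteq> X" "x \<noteq> y" "x \<noteq> z" "y \<noteq> z"
    and c: "c {x, y} = c {x, z}" "c {y, z} = c {x, z}"
    by blast
  have "c e = c {x, z}" if "e \<in> [T]\<^bsup>2\<^esup>" for e
  proof -
    from that obtain u v where "e = {u, v}" "u \<noteq> v" "u \<in> T" "v \<in> T"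
      by (auto simp: nsets_def card_2_iff)
    with xyz(1) c show ?thesis
      by (auto simp: insert_commute)
  qed
  moreover have "T \<in> [X]\<^bsup>3\<^esup>"
    using xyz by (simp add: nsets_def)
  ultimately show ?L
    unfolding monochromatic_triangle_def by blast
qed

lemma two_pow_cases: "x \<in> two_pow r \<Longrightarrow> i \<in> Field r \<Longrightarrow> x i = 0 \<or> x i = 1"
  by (auto simp: two_pow_def)

context
  fixes r :: "'k rel"
  assumes wo: "Well_order r"
begin

interpretation wo_rel r
  by (simp add: wo_rel_def wo)

lemma Delta_differ:
  assumes "x \<in> two_pow r" "y \<in> two_pow r" "x \<noteq> y"
  shows "Delta r {x, y} \<in> Field r \<and> x (Delta r {x, y}) \<noteq> y (Delta r {x, y})"
proof -
  \<comment> \<open>Members of \<open>two_pow r\<close> are extensional: off \<open>Field r\<close>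
    both are \<open>undefined\<close>, so distinct ones differ somewhere in
    \<open>Field r\<close>.\<close>
  have "{i \<in> Field r. x i \<noteq> y i} \<noteq> {}"
    using assms PiE_ext[of x "Field r" "\<lambda>_. {0, 1}" y] by (auto simp: two_pow_def)
  then show ?thesis
    using minim_in[of "{i \<in> Field r. x i \<noteq> y i}"] by (auto simp: Delta_pair)
qed

lemma Delta_eqI:
  assumes "i \<in> Field r" "x i \<noteq> y i" "\<And>j. (j, i) \<in> r - Id \<Longrightarrow> x j = y j"
  shows "Delta r {x, y} = i"
proof -
  \<comment> \<open>By totality the alternative is that \<open>j\<close> lies strictly below
    \<open>i\<close>, where \<open>x\<close> and \<open>y\<close> agree.\<close>
  have "(i, j) \<in> r" if "j \<in> Field r" "x j \<noteq> y j" for j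
    using assms that TOTALS REFL by (auto simp: refl_on_def)
  with assms show ?thesis
    unfolding Delta_pair by (intro equals_minim[symmetric]) auto
qed

lemma Delta_in_colouring: "Delta r \<in> [two_pow r]\<^bsup>2\<^esup> \<rightarrow> Field r"
proof
  fix e assume "e \<in> [two_pow r]\<^bsup>2\<^esup>"
  then obtain x y where "e = {x, y}" "x \<noteq> y" "x \<in> two_pow r" "y \<in> two_pow r"
    by (auto simp: nsets_def card_2_iff)
  then show "Delta r e \<in> Field r"
    using Delta_differ by simp
qed

lemma Delta_triangle_free: "\<not> monochromatic_triangle (two_pow r) (Delta r) T"
proof
  assume "monochromatic_triangle (two_pow r) (Delta r) T"
  then obtain x y z where xyz: "x \<in> two_pow r" "y \<in> two_pow r" "z \<in> two_pow r"
      and neq: "x \<noteq> y" "x \<noteq> z" "y \<noteq> z"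
      and eq: "Delta r {x, y} = Delta r {x, z}" "Delta r {y, z} = Delta r {x, z}"
    by (auto simp: monochromatic_triangle_iff)
  define i where "i = Delta r {x, z}"
  have i: "i \<in> Field r" and "x i \<noteq> y i" "x i \<noteq> z i" "y i \<noteq> z i"
    using Delta_differ[OF xyz(1,2) neq(1)] Delta_differ[OF xyz(1,3) neq(2)]
      Delta_differ[OF xyz(2,3) neq(3)]
    unfolding eq i_def by blast+
  moreover have "x i = 0 \<or> x i = 1" "y i = 0 \<or> y i = 1" "z i = 0 \<or> z i = 1"
    using xyz[THEN two_pow_cases, OF i] by simp_all
  ultimately show False
    by metis
qed

lemma ex_Delta_eq_colour:
  assumes f: "f \<in> two_pow r \<rightarrow> Field r"
  shows "\<exists>x\<in>two_pow r. \<exists>y\<in>two_pow r. x \<noteq> y \<and> f x = Delta r {x, y} \<and> f y = Delta r {x, y}"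
proof -
  \<comment> \<open>\<open>Q g i\<close> consults \<open>g\<close> strictly below \<open>i\<close>
    only, so its truth value may decide \<open>g i\<close> in a well-founded recursion.\<close>
  define Q where "Q g i \<longleftrightarrow>
    (\<exists>y\<in>two_pow r. f y = i \<and> y i = 1 \<and> (\<forall>j. (j, i) \<in> r - Id \<longrightarrow> y j = g j))"
    for g :: "'k \<Rightarrow> nat" and i
  have "\<exists>g. \<forall>i. g i = (if Q g i then 0 else 1)"
  \<comment> \<open>The relation chosen from is the graph of the recursion equation; the goal shown
    explicitly is its locality, and existence of a value is immediate.\<close>
  proof (rule dependent_wf_choice[OF WF])
    show "(v = (if Q g i then 0 else 1)) = (v = (if Q h i then 0 else 1))"
      if "\<And>j. (j, i) \<in> r - Id \<Longrightarrow> g j = h j" for g h i and v :: nat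
      using that by (auto simp: Q_def)
  qed simp
  then obtain g where g: "\<And>i. g i = (if Q g i then 0 else 1)"
    by blast
  \<comment> \<open>The recursion yields \<open>g\<close> on the whole type; restricting makes it
    extensional without changing it on \<open>Field r\<close>.\<close>
  define x where "x = restrict g (Field r)"
  have x: "x \<in> two_pow r"
    using g by (auto simp: x_def two_pow_def)
  define i where "i = f x"
  have i: "i \<in> Field r"
    using f x by (auto simp: i_def)
  have below: "x j = g j" if "(j, i) \<in> r - Id" for j
    using that by (auto simp: x_def Field_def)
  have "Q g i"
  proof (rule ccontr)
    assume "\<not> Q g i"
    moreover from this have "x i = 1"
      using g[of i] i by (simp add: x_def)
    ultimately show False
      using x below by (auto simp: Q_def i_def)
  qed
  then obtain y where y: "y \<in> two_pow r" "f y = i" "y i = 1"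
      and agree: "\<And>j. (j, i) \<in> r - Id \<Longrightarrow> y j = g j"
    unfolding Q_def by blast
  have "x i = 0"
    using g[of i] \<open>Q g i\<close> i by (simp add: x_def)
  \<comment> \<open>Both \<open>x\<close> and \<open>y\<close> follow \<open>g\<close> below
    \<open>i\<close> and take the values 0 and 1 at \<open>i\<close>, so they first part at
    \<open>i\<close>, their common colour under \<open>f\<close>.\<close>
  then have "Delta r {x, y} = i"
    using i y(3) below agree by (intro Delta_eqI) auto
  moreover have "x \<noteq> y"
    using \<open>x i = 0\<close> y(3) by auto
  ultimately show ?thesis
    using x y unfolding i_def by metis
qed

lemma extension_has_monochromatic_triangle:
  fixes Y :: "(('k \<Rightarrow> nat) + 'b) set"
  assumes Y: "Inl ` two_pow r \<subset> Y" and c': "c' \<in> [Y]\<^bsup>2\<^esup> \<rightarrow> Field r"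
    and ext: "\<forall>e\<in>[two_pow r]\<^bsup>2\<^esup>. c' (Inl ` e) = Delta r e"
  shows "\<exists>T. monochromatic_triangle Y c' T"
proof -
  from Y obtain z where z: "z \<in> Y" "z \<notin> Inl ` two_pow r"
    by blast
  \<comment> \<open>As \<open>z\<close> is outside the image of \<open>Inl\<close>, these are
    genuine pairs, and \<open>c'\<close> colours them in \<open>Field r\<close>.\<close>
  have "{z, Inl x} \<in> [Y]\<^bsup>2\<^esup>" if "x \<in> two_pow r" for x
    using z Y that by (auto simp: nsets_def card_2_iff)
  then have "(\<lambda>x. c' {z, Inl x}) \<in> two_pow r \<rightarrow> Field r"
    using c' by blast
  from ex_Delta_eq_colour[OF this] obtain x y where xy: "x \<in> two_pow r" "y \<in> two_pow r" "x \<noteq> y"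
    and D: "c' {z, Inl x} = Delta r {x, y}" "c' {z, Inl y} = Delta r {x, y}"
    by blast
  have "{x, y} \<in> [two_pow r]\<^bsup>2\<^esup>"
    using xy by (auto simp: nsets_def)
  \<comment> \<open>\<open>{Inl x, Inl y}\<close> is the image of \<open>{x, y}\<close> under
    \<open>Inl\<close>, so the third side keeps its old colour.\<close>
  with ext have "c' {Inl x, Inl y} = Delta r {x, y}"
    by fastforce
  then have "monochromatic_triangle Y c' {z, Inl x, Inl y}"
    unfolding monochromatic_triangle_iff using z Y xy D
    by (intro exI[of _ z] exI[of _ "Inl x"] exI[of _ "Inl y"]) auto
  then show ?thesis ..
qed

end

theorem proposition3p3:
  fixes r :: "'k rel"
  assumes "Cinfinite r"
  shows "maximal_triangle_free_colouring TYPE('b) (Field r) (two_pow r) (Delta r)"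
proof -
  have wo: "Well_order r"
    using assms by (simp add: card_order_on_well_order_on)
  show ?thesis
    unfolding maximal_triangle_free_colouring_def
  proof (intro conjI allI impI notI)
    show "Delta r \<in> [two_pow r]\<^bsup>2\<^esup> \<rightarrow> Field r"
      by (rule Delta_in_colouring[OF wo])
    show False if "\<exists>T. monochromatic_triangle (two_pow r) (Delta r) T"
      using that Delta_triangle_free[OF wo] by blast
  qed (rule extension_has_monochromatic_triangle[OF wo])
qed

end
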